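(* Let $i: H\hookrightarrow G$ be an inclusion of two non-abelian finite simple groups and assume that $H$ is superperfect. Let $q_G:\tilde G\twoheadrightarrow G$ be the universal central extension of $G$ and let $j: H=\tilde H\hookrightarrow\tilde G$ denote the induced homomorphism on the universal central extensions, i.e. the unique homomorphism with $q_G\circ j=i$. Then $i:H\hookrightarrow G$ is a localization if and only if $j:H\hookrightarrow\tilde G$ is a localization.
   Context: A group homomorphism $\varphi:A\to B$ is called a localization if precomposition with $\varphi$ induces a bijection $\varphi^*:\mathrm{Hom}(B,B)\to\mathrm{Hom}(A,B)$, $f\mapsto f\circ\varphi$. A group $H$ is superperfect if $H_1(H;\mathbb{Z})=0$ and $H_2(H;\mathbb{Z})=0$; for a superperfect group the universal central extension $\tilde H\twoheadrightarrow H$ is an isomorphism, so $\tilde H=H$. For a non-abelian finite simple group $G$, the universal central extension is $\mathrm{Mult}(G)\hookrightarrow\tilde G\twoheadrightarrow G$ with $\mathrm{Mult}(G)=H_2(G;\mathbb{Z})$ the Schur multiplier. *)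

theory Defs
  imports "HOL-Algebra.Weak_Morphisms" "HOL-Algebra.SimpleGroups" "HOL-Algebra.Free_Abelian_Groups"
begin

section \<open>Localizations\<close>

text \<open>In \<open>HOL-Algebra\<close> a homomorphism is a total function that is constrained on the carrier only.
  Restricting to extensional functions makes the set of homomorphisms the mathematical Hom-set.\<close>

definition Hom :: "('a, 'x) monoid_scheme \<Rightarrow> ('b, 'y) monoid_scheme \<Rightarrow> ('a \<Rightarrow> 'b) set"
  where "Hom A B = hom A B \<inter> extensional (carrier A)"

definition localization ::
    "('a, 'x) monoid_scheme \<Rightarrow> ('b, 'y) monoid_scheme \<Rightarrow> ('a \<Rightarrow> 'b) \<Rightarrow> bool"
  where "localization A B \<phi> \<longleftrightarrow>
    \<phi> \<in> hom A B \<and> bij_betw (\<lambda>f. compose (carrier A) f \<phi>) (Hom B B) (Hom A B)"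

section \<open>Integral group homology\<close>

text \<open>The inhomogeneous bar complex with trivial integer coefficients: the \<open>n\<close>-chains are the free
  abelian group on lists \<open>[g\<^sub>1, \<dots>, g\<^sub>n]\<close> of elements of \<open>G\<close>, and the faces of such a list are
  \<open>[g\<^sub>2, \<dots>, g\<^sub>n]\<close>, then \<open>[g\<^sub>1, \<dots>, g\<^sub>k g\<^sub>k\<^sub>+\<^sub>1, \<dots>, g\<^sub>n]\<close> for \<open>0 < k < n\<close>, and \<open>[g\<^sub>1, \<dots>, g\<^sub>n\<^sub>-\<^sub>1]\<close>.\<close>

definition bar_chain_group :: "nat \<Rightarrow> ('a, 'x) monoid_scheme \<Rightarrow> ('a list \<Rightarrow>\<^sub>0 int) monoid"
  where "bar_chain_group n G =
    free_Abelian_group {xs. length xs = n \<and> set xs \<subseteq> carrier G}"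

definition bar_face :: "('a, 'x) monoid_scheme \<Rightarrow> nat \<Rightarrow> nat \<Rightarrow> 'a list \<Rightarrow> 'a list"
  where "bar_face G n k xs =
    (if k = 0 then tl xs
     else if k = n then butlast xs
     else take (k - 1) xs @ [xs ! (k - 1) \<otimes>\<^bsub>G\<^esub> xs ! k] @ drop (k + 1) xs)"

definition bar_boundary ::
    "('a, 'x) monoid_scheme \<Rightarrow> nat \<Rightarrow> ('a list \<Rightarrow>\<^sub>0 int) \<Rightarrow> ('a list \<Rightarrow>\<^sub>0 int)"
  where "bar_boundary G n c =
    (if n = 0 then 0
     else frag_extend (\<lambda>xs. \<Sum>k\<le>n. frag_cmul ((-1) ^ k) (frag_of (bar_face G n k xs))) c)"

definition bar_cycles :: "nat \<Rightarrow> ('a, 'x) monoid_scheme \<Rightarrow> ('a list \<Rightarrow>\<^sub>0 int) set"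
  where "bar_cycles n G = {c \<in> carrier (bar_chain_group n G). bar_boundary G n c = 0}"

definition bar_boundaries :: "nat \<Rightarrow> ('a, 'x) monoid_scheme \<Rightarrow> ('a list \<Rightarrow>\<^sub>0 int) set"
  where "bar_boundaries n G = bar_boundary G (n + 1) ` carrier (bar_chain_group (n + 1) G)"

definition group_homology :: "nat \<Rightarrow> ('a, 'x) monoid_scheme \<Rightarrow> ('a list \<Rightarrow>\<^sub>0 int) set monoid"
  where "group_homology n G =
    subgroup_generated (bar_chain_group n G) (bar_cycles n G) Mod bar_boundaries n G"

definition superperfect :: "('a, 'x) monoid_scheme \<Rightarrow> bool"
  where "superperfect G \<longleftrightarrow>
    group G \<and> trivial_group (group_homology 1 G) \<and> trivial_group (group_homology 2 G)"

section \<open>Universal central extensions\<close>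

definition central_extension ::
    "('e, 'x) monoid_scheme \<Rightarrow> ('g, 'y) monoid_scheme \<Rightarrow> ('e \<Rightarrow> 'g) \<Rightarrow> bool"
  where "central_extension E G q \<longleftrightarrow>
    group E \<and> group G \<and> q \<in> epi E G \<and>
    (\<forall>z \<in> kernel E G q. \<forall>x \<in> carrier E. z \<otimes>\<^bsub>E\<^esub> x = x \<otimes>\<^bsub>E\<^esub> z)"

text \<open>A definition cannot quantify over the carrier type of the competing central extension, so
  it ranges over groups with elements of type \<open>'e list\<close>, where \<open>'e\<close> is the element type of the
  extension under consideration. This loses no generality: the lemma
  \<open>universal_central_extension_lift\<close> below gives the universal property for competing central
  extensions with elements of any type.\<close>

definition universal_central_extension ::
    "('e, 'x) monoid_scheme \<Rightarrow> ('g, 'y) monoid_scheme \<Rightarrow> ('e \<Rightarrow> 'g) \<Rightarrow> bool"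
  where "universal_central_extension E G q \<longleftrightarrow>
    central_extension E G q \<and>
    (\<forall>(E' :: 'e list monoid) q'. central_extension E' G q' \<longrightarrow>
      (\<exists>!f. f \<in> Hom E E' \<and> (\<forall>x \<in> carrier E. q' (f x) = q x)))"

lemma central_extension_image_group:
  assumes S: "central_extension S G p" and inj: "inj_on \<phi> (carrier S)"
  shows "central_extension (image_group \<phi> S) G (p \<circ> inv_into (carrier S) \<phi>)"
    and "\<phi> \<in> iso S (image_group \<phi> S)"
proof -
  let ?T = "image_group \<phi> S" and ?\<psi> = "inv_into (carrier S) \<phi>"
  interpret S: group S using S by (simp add: central_extension_def)
  have "weak_group_morphism \<phi> {\<one>\<^bsub>S\<^esub>} S"
  proof (rule weak_group_morphismsI)
    show "{\<one>\<^bsub>S\<^esub>} \<lhd> S" by (rule S.one_is_normal)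
    show "\<phi> a = \<phi> b \<longleftrightarrow> a \<otimes>\<^bsub>S\<^esub> inv\<^bsub>S\<^esub> b \<in> {\<one>\<^bsub>S\<^esub>}"
      if "a \<in> carrier S" "b \<in> carrier S" for a b
      using that inj_on_eq_iff[OF inj that] S.inv_solve_right[of "\<one>\<^bsub>S\<^esub>" a b] by auto
  qed
  then have T: "group ?T" and \<phi>: "\<phi> \<in> hom S ?T"
    by (auto intro: S.image_group_is_group S.weak_group_morphism_is_hom)
  show iso: "\<phi> \<in> iso S ?T"
    using \<phi> inj by (simp add: iso_def bij_betw_def image_group_carrier)
  have \<psi>: "?\<psi> \<in> iso ?T S" using S.iso_set_sym[OF iso]
    by (simp add: image_group_carrier)
  have \<psi>m: "?\<psi> (x \<otimes>\<^bsub>?T\<^esub> y) = ?\<psi> x \<otimes>\<^bsub>S\<^esub> ?\<psi> y" "?\<psi> x \<in> carrier S"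
    if "x \<in> carrier ?T" "y \<in> carrier ?T" for x y
    using \<psi> that by (auto simp: iso_def hom_def)
  have \<psi>e: "?\<psi> \<in> epi ?T S" and "p \<in> epi S G"
    using \<psi> S by (auto simp: iso_iff_mon_epi central_extension_def)
  then have epi: "p \<circ> ?\<psi> \<in> epi ?T G" by (rule epi_compose)
  have "z \<otimes>\<^bsub>?T\<^esub> x = x \<otimes>\<^bsub>?T\<^esub> z"
    if z: "z \<in> kernel ?T G (p \<circ> ?\<psi>)" and x: "x \<in> carrier ?T" for z x
  proof -
    have zc: "z \<in> carrier ?T" using z by (simp add: kernel_def)
    have "?\<psi> z \<otimes>\<^bsub>S\<^esub> ?\<psi> x = ?\<psi> x \<otimes>\<^bsub>S\<^esub> ?\<psi> z"
      using S z x zc \<psi>m by (auto simp: central_extension_def kernel_def)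
    then have "?\<psi> (z \<otimes>\<^bsub>?T\<^esub> x) = ?\<psi> (x \<otimes>\<^bsub>?T\<^esub> z)"
      using \<psi>m zc x by simp
    moreover have "inj_on ?\<psi> (carrier ?T)" using \<psi> by (simp add: iso_iff_mon_epi mon_def)
    moreover have "z \<otimes>\<^bsub>?T\<^esub> x \<in> carrier ?T" "x \<otimes>\<^bsub>?T\<^esub> z \<in> carrier ?T"
      using T zc x by (auto intro: monoid.m_closed group.is_monoid)
    ultimately show ?thesis by (auto dest: inj_onD)
  qed
  then show "central_extension ?T G (p \<circ> ?\<psi>)"
    using T S epi unfolding central_extension_def by blast
qed

lemma universal_central_extension_lift_embedded:
  fixes E :: "('e, 'x) monoid_scheme" and \<phi> :: "'s \<Rightarrow> 'e list"
  assumes U: "universal_central_extension E G q"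
    and S: "central_extension S G p" and inj: "inj_on \<phi> (carrier S)"
  shows "\<exists>!f. f \<in> Hom E S \<and> (\<forall>x \<in> carrier E. p (f x) = q x)"
proof -
  let ?T = "image_group \<phi> S" and ?\<psi> = "inv_into (carrier S) \<phi>"
  interpret E: group E using U
    by (simp add: universal_central_extension_def central_extension_def)
  interpret S: group S using S by (simp add: central_extension_def)
  note T = central_extension_image_group[OF S inj]
  have \<psi>: "?\<psi> \<in> iso ?T S" using S.iso_set_sym[OF T(2)] by (simp add: image_group_carrier)
  have ex1: "\<exists>!f. f \<in> Hom E ?T \<and> (\<forall>x \<in> carrier E. (p \<circ> ?\<psi>) (f x) = q x)"
    using U T(1) unfolding universal_central_extension_def by blast
  then obtain f where f: "f \<in> Hom E ?T" "\<And>x. x \<in> carrier E \<Longrightarrow> p (?\<psi> (f x)) = q x"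
    by auto
  show ?thesis
  proof (rule ex_ex1I)
    have "compose (carrier E) ?\<psi> f \<in> hom E S"
      using f(1) \<psi> E.is_group by (auto simp: Hom_def iso_def hom_def compose_def Pi_iff)
    then show "\<exists>f. f \<in> Hom E S \<and> (\<forall>x \<in> carrier E. p (f x) = q x)"
      using f(2) by (intro exI[of _ "compose (carrier E) ?\<psi> f"])
        (auto simp: Hom_def compose_def)
  next
    fix g h
    assume g: "g \<in> Hom E S \<and> (\<forall>x \<in> carrier E. p (g x) = q x)"
      and h: "h \<in> Hom E S \<and> (\<forall>x \<in> carrier E. p (h x) = q x)"
    have *: "compose (carrier E) \<phi> k \<in> Hom E ?T \<and>
        (\<forall>x \<in> carrier E. (p \<circ> ?\<psi>) (compose (carrier E) \<phi> k x) = q x)"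
      if "k \<in> Hom E S \<and> (\<forall>x \<in> carrier E. p (k x) = q x)" for k
      using that T(2) inj by (auto simp: Hom_def iso_def hom_def compose_def Pi_iff)
    have eq: "compose (carrier E) \<phi> g = compose (carrier E) \<phi> h"
      using ex1 *[OF g] *[OF h] by blast
    show "g = h"
    proof (rule extensionalityI[of _ "carrier E"])
      show "g \<in> extensional (carrier E)" "h \<in> extensional (carrier E)"
        using g h by (auto simp: Hom_def)
      fix x assume x: "x \<in> carrier E"
      then have "\<phi> (g x) = \<phi> (h x)" using fun_cong[OF eq, of x] by (simp add: compose_def)
      moreover have "g x \<in> carrier S" "h x \<in> carrier S"
        using g h x by (auto simp: Hom_def hom_def)
      ultimately show "g x = h x" using inj by (auto dest: inj_onD)
    qed
  qed
qed

text \<open>For uniqueness, two lifts differ by a homomorphism into the central kernel, and this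
  difference is detected by the product of \<open>G\<close> with its image. For existence, the quotients of
  lifts to \<open>E'\<close> of elements of \<open>E\<close> generate a central extension of \<open>G\<close> inside \<open>E'\<close> whose
  elements are values of words, that is, of lists of elements of \<open>E\<close>.\<close>

fun word_value :: "('b, 'y) monoid_scheme \<Rightarrow> ('e \<Rightarrow> 'b) \<Rightarrow> 'e list \<Rightarrow> 'b" where
  "word_value B s (a # b # w) = (s a \<otimes>\<^bsub>B\<^esub> inv\<^bsub>B\<^esub> s b) \<otimes>\<^bsub>B\<^esub> word_value B s w"
| "word_value B s w = \<one>\<^bsub>B\<^esub>"

lemma (in group) word_value_closed:
  "s ` set w \<subseteq> carrier G \<Longrightarrow> word_value G s w \<in> carrier G"
  by (induction w rule: induct_list012) auto

lemma (in group) word_value_append: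
  "even (length v) \<Longrightarrow> s ` set v \<subseteq> carrier G \<Longrightarrow> s ` set w \<subseteq> carrier G \<Longrightarrow>
    word_value G s (v @ w) = word_value G s v \<otimes> word_value G s w"
proof (induction v rule: induct_list012)
  case (3 a b v)
  then have "word_value G s v \<in> carrier G" "word_value G s w \<in> carrier G"
    by (auto intro!: word_value_closed)
  with 3 show ?case by (simp add: m_assoc)
qed (auto simp: word_value_closed)

lemma (in group) generate_word_value:
  assumes s: "s ` V \<subseteq> carrier G"
    and y: "y \<in> generate G ((\<lambda>(a, b). s a \<otimes> inv s b) ` (V \<times> V))"
  shows "\<exists>w. even (length w) \<and> set w \<subseteq> V \<and> y = word_value G s w"
  using y
proof (induction rule: generate.induct)
  case one
  show ?case by (rule exI[of _ "[]"]) simp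
next
  case (incl h)
  then obtain a b where "a \<in> V" "b \<in> V" "h = s a \<otimes> inv s b" by auto
  then show ?case using s by (intro exI[of _ "[a, b]"]) (auto simp: image_subset_iff)
next
  case (inv h)
  then obtain a b where "a \<in> V" "b \<in> V" "h = s a \<otimes> inv s b" by auto
  then show ?case using s
    by (intro exI[of _ "[b, a]"]) (auto simp: image_subset_iff inv_mult_group)
next
  case (eng h1 h2)
  then obtain v w where
      "even (length v)" "set v \<subseteq> V" "h1 = word_value G s v"
      "even (length w)" "set w \<subseteq> V" "h2 = word_value G s w"
    by blast
  moreover from this have "s ` set v \<subseteq> carrier G" "s ` set w \<subseteq> carrier G" using s by auto
  ultimately show ?case by (intro exI[of _ "v @ w"]) (simp add: word_value_append)
qed

lemma universal_central_extension_unique: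
  assumes U: "universal_central_extension E G q" and C: "central_extension E' G q'"
    and f: "f \<in> hom E E'" "\<And>x. x \<in> carrier E \<Longrightarrow> q' (f x) = q x"
    and g: "g \<in> hom E E'" "\<And>x. x \<in> carrier E \<Longrightarrow> q' (g x) = q x"
    and x: "x \<in> carrier E"
  shows "f x = g x"
proof -
  have CE: "central_extension E G q" using U by (simp add: universal_central_extension_def)
  interpret E: group E using CE by (simp add: central_extension_def)
  interpret G: group G using CE by (simp add: central_extension_def)
  interpret E': group E' using C by (simp add: central_extension_def)
  interpret f: group_hom E E' f using f(1) by unfold_locales
  interpret g: group_hom E E' g using g(1) by unfold_locales
  have qh: "q \<in> hom E G" and qsurj: "q ` carrier E = carrier G" and q'h: "q' \<in> hom E' G"
    using CE C by (auto simp: central_extension_def epi_def)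
  interpret q: group_hom E G q using qh by unfold_locales
  interpret q': group_hom E' G q' using q'h by unfold_locales
  have central: "z \<otimes>\<^bsub>E'\<^esub> y = y \<otimes>\<^bsub>E'\<^esub> z"
    if "z \<in> carrier E'" "q' z = \<one>\<^bsub>G\<^esub>" "y \<in> carrier E'" for z y
    using C that by (auto simp: central_extension_def kernel_def)
  define d where "d y = f y \<otimes>\<^bsub>E'\<^esub> inv\<^bsub>E'\<^esub> g y" for y
  have dc: "d y \<in> carrier E'" and dq: "q' (d y) = \<one>\<^bsub>G\<^esub>" if "y \<in> carrier E" for y
    using that f(2) g(2) by (auto simp: d_def)
  have dh: "d (y \<otimes>\<^bsub>E\<^esub> z) = d y \<otimes>\<^bsub>E'\<^esub> d z" if y: "y \<in> carrier E" and z: "z \<in> carrier E" for y z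
  proof -
    have "d (y \<otimes>\<^bsub>E\<^esub> z) = f y \<otimes>\<^bsub>E'\<^esub> (d z \<otimes>\<^bsub>E'\<^esub> inv\<^bsub>E'\<^esub> g y)"
      using y z by (simp add: d_def E'.inv_mult_group E'.m_assoc)
    also have "\<dots> = f y \<otimes>\<^bsub>E'\<^esub> (inv\<^bsub>E'\<^esub> g y \<otimes>\<^bsub>E'\<^esub> d z)"
      using central[OF dc[OF z] dq[OF z], of "inv\<^bsub>E'\<^esub> g y"] y by simp
    also have "\<dots> = d y \<otimes>\<^bsub>E'\<^esub> d z" using y z dc[OF z] by (simp add: d_def E'.m_assoc)
    finally show ?thesis .
  qed
  have d_hom: "d \<in> hom E E'" using dc dh by (auto simp: hom_def)
  interpret d: group_hom E E' d using d_hom by unfold_locales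
  define D where "D = E'\<lparr>carrier := d ` carrier E\<rparr>"
  have D: "group D" unfolding D_def
    using d.img_is_subgroup E'.subgroup_imp_group by blast
  define P where "P = G \<times>\<times> D"
  have cP: "carrier P = carrier G \<times> d ` carrier E" by (simp add: P_def D_def)
  have multP: "u \<otimes>\<^bsub>P\<^esub> v = (fst u \<otimes>\<^bsub>G\<^esub> fst v, snd u \<otimes>\<^bsub>E'\<^esub> snd v)" for u v
    by (simp add: P_def D_def DirProd_def split: prod.split)
  have P: "group P" unfolding P_def using D G.is_group by (rule DirProd_group[rotated])
  have "fst \<in> epi P G"
    using d.one_closed E.one_closed by (auto simp: epi_def hom_def cP multP image_iff)
  moreover have "z \<otimes>\<^bsub>P\<^esub> y = y \<otimes>\<^bsub>P\<^esub> z" if "z \<in> kernel P G fst" "y \<in> carrier P" for z y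
    using that central dc dq by (auto simp: kernel_def cP multP)
  ultimately have CP: "central_extension P G fst"
    using P G.is_group unfolding central_extension_def by blast
  define \<phi> where "\<phi> u = [inv_into (carrier E) q (fst u), inv_into (carrier E) d (snd u)]" for u
  have inj: "inj_on \<phi> (carrier P)"
  proof (rule inj_onI)
    fix u v assume u: "u \<in> carrier P" and v: "v \<in> carrier P" and e: "\<phi> u = \<phi> v"
    have "fst u \<in> q ` carrier E" "fst v \<in> q ` carrier E" "snd u \<in> d ` carrier E"
        "snd v \<in> d ` carrier E"
      using u v qsurj by (auto simp: cP)
    then have "fst u = fst v" "snd u = snd v"
      using e unfolding \<phi>_def by (metis f_inv_into_f list.inject)+
    then show "u = v" by (rule prod_eqI)
  qed
  let ?h = "\<lambda>y\<in>carrier E. (q y, d y)" and ?k = "\<lambda>y\<in>carrier E. (q y, \<one>\<^bsub>E'\<^esub>)"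
  have one: "\<one>\<^bsub>E'\<^esub> \<in> d ` carrier E" using d.hom_one E.one_closed by (metis image_eqI)
  have "?h \<in> Hom E P" "?k \<in> Hom E P"
    using one by (auto simp: Hom_def hom_def cP multP dh)
  then have "?h = ?k"
    using universal_central_extension_lift_embedded[OF U CP inj] by (auto simp: restrict_def)
  then have "?h x = ?k x" by simp
  then have "d x = \<one>\<^bsub>E'\<^esub>" using x by simp
  then show ?thesis using x E'.inv_equality[of "f x" "inv\<^bsub>E'\<^esub> g x"] by (simp add: d_def)
qed

lemma universal_central_extension_lift:
  fixes E' :: "('c, 'z) monoid_scheme"
  assumes U: "universal_central_extension E G q" and C: "central_extension E' G q'"
  shows "\<exists>!f. f \<in> Hom E E' \<and> (\<forall>x \<in> carrier E. q' (f x) = q x)"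
proof (rule ex_ex1I)
  have CE: "central_extension E G q" using U by (simp add: universal_central_extension_def)
  interpret E: group E using CE by (simp add: central_extension_def)
  interpret G: group G using CE by (simp add: central_extension_def)
  interpret E': group E' using C by (simp add: central_extension_def)
  have qh: "q \<in> hom E G" and qsurj: "q ` carrier E = carrier G"
    and q'h: "q' \<in> hom E' G" and q'surj: "q' ` carrier E' = carrier G"
    using CE C by (auto simp: central_extension_def epi_def)
  interpret q: group_hom E G q using qh by unfold_locales
  interpret q': group_hom E' G q' using q'h by unfold_locales
  define s where "s e = inv_into (carrier E') q' (q e)" for e
  have sc: "s e \<in> carrier E'" and sq: "q' (s e) = q e" if "e \<in> carrier E" for e
  proof -
    have "q e \<in> q' ` carrier E'" using that q'surj by auto
    then show "s e \<in> carrier E'" "q' (s e) = q e"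
      unfolding s_def by (auto intro: inv_into_into f_inv_into_f)
  qed
  define Y where "Y = (\<lambda>(a, b). s a \<otimes>\<^bsub>E'\<^esub> inv\<^bsub>E'\<^esub> s b) ` (carrier E \<times> carrier E)"
  have Yc: "Y \<subseteq> carrier E'" using sc by (auto simp: Y_def)
  define S where "S = E'\<lparr>carrier := generate E' Y\<rparr>"
  have sub: "generate E' Y \<subseteq> carrier E'" using E'.generate_incl[OF Yc] .
  have S: "group S" unfolding S_def
    using E'.subgroup_imp_group[OF E'.generate_is_subgroup[OF Yc]] .
  have "q' ` generate E' Y = carrier G"
  proof
    show "q' ` generate E' Y \<subseteq> carrier G" using sub by auto
    show "carrier G \<subseteq> q' ` generate E' Y"
    proof
      fix x assume "x \<in> carrier G"
      then obtain e where e: "e \<in> carrier E" "x = q e" using qsurj by auto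
      have "s e \<otimes>\<^bsub>E'\<^esub> inv\<^bsub>E'\<^esub> s \<one>\<^bsub>E\<^esub> \<in> generate E' Y"
        using e by (auto simp: Y_def intro!: generate.incl)
      moreover have "q' (s e \<otimes>\<^bsub>E'\<^esub> inv\<^bsub>E'\<^esub> s \<one>\<^bsub>E\<^esub>) = x"
        using e sc sq by simp
      ultimately show "x \<in> q' ` generate E' Y" by (metis image_eqI)
    qed
  qed
  then have "q' \<in> epi S G" using sub
    by (auto simp: epi_def hom_def S_def subset_iff intro!: q'.hom_mult)
  then have CS: "central_extension S G q'"
    using S G.is_group C sub by (auto simp: central_extension_def kernel_def S_def)
  define \<phi> where "\<phi> y = (SOME w. y = word_value E' s w)" for y
  have \<phi>: "y = word_value E' s (\<phi> y)" if "y \<in> carrier S" for y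
  proof -
    have "\<exists>w. y = word_value E' s w"
      using E'.generate_word_value[of s "carrier E" y] sc that
      by (auto simp: S_def Y_def image_subset_iff)
    then show ?thesis unfolding \<phi>_def by (rule someI_ex)
  qed
  have inj: "inj_on \<phi> (carrier S)"
  proof (rule inj_onI)
    fix u v assume "u \<in> carrier S" "v \<in> carrier S" and e: "\<phi> u = \<phi> v"
    then have "u = word_value E' s (\<phi> u)" "v = word_value E' s (\<phi> v)" using \<phi> by blast+
    then show "u = v" using e by simp
  qed
  obtain f where "f \<in> Hom E S" "\<forall>x \<in> carrier E. q' (f x) = q x"
    using universal_central_extension_lift_embedded[OF U CS inj] by blast
  moreover from this have "f \<in> Hom E E'" using sub by (auto simp: Hom_def hom_def S_def)
  ultimately show "\<exists>f. f \<in> Hom E E' \<and> (\<forall>x \<in> carrier E. q' (f x) = q x)" by blast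
next
  fix f g
  assume "f \<in> Hom E E' \<and> (\<forall>x \<in> carrier E. q' (f x) = q x)"
    and "g \<in> Hom E E' \<and> (\<forall>x \<in> carrier E. q' (g x) = q x)"
  then show "f = g"
    using universal_central_extension_unique[OF U C]
    by (intro extensionalityI[of _ "carrier E"]) (auto simp: Hom_def)
qed

end

theory Submission
  imports Defs
begin

text \<open>Since \<open>q \<circ> j = i\<close>,
  precomposition with \<open>i\<close> on \<open>Hom(G, G)\<close> is the composite
  \<open>Hom(G, G) \<rightarrow> Hom(Gt, G) \<rightarrow> Hom(H, G)\<close> of precomposition with \<open>q\<close> and with \<open>j\<close>, and
  postcomposition with \<open>q\<close> carries precomposition with \<open>j\<close> on \<open>Hom(Gt, Gt)\<close> to precomposition
  with \<open>j\<close> on \<open>Hom(Gt, G)\<close>. So the two localization properties are equivalent as soon as the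
  following three maps, all induced by \<open>q\<close>, are bijections.

  \<^item> \<open>Hom(H, Gt) \<rightarrow> Hom(H, G)\<close>: every homomorphism \<open>u\<close> from \<open>H\<close> to \<open>G\<close> lifts, because the
    2-cocycle with values in the kernel of \<open>q\<close> that obstructs the lift is a coboundary
    (\<open>superperfect_cocycle_imp_coboundary\<close>, \<open>superperfect_lift\<close>). Two lifts differ by a
    homomorphism into the abelian kernel, which is trivial because \<open>H\<close> is simple and non-abelian.

  \<^item> \<open>Hom(G, G) \<rightarrow> Hom(Gt, G)\<close>: it is injective because \<open>q\<close> is onto, and it is surjective because
    every homomorphism from \<open>Gt\<close> to the finite simple group \<open>G\<close> kills the kernel of \<open>q\<close>
    (\<open>hom_to_finite_simple_group_kills_kernel\<close>).

  \<^item> \<open>Hom(Gt, Gt) \<rightarrow> Hom(Gt, G)\<close>: by the previous item a homomorphism from \<open>Gt\<close> to \<open>G\<close> has the form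
    \<open>g \<circ> q\<close>, and it lifts by the universal property applied to the pullback of \<open>q\<close> along \<open>g\<close>.
    Lifts are unique because \<open>Gt\<close> is perfect.\<close>

section \<open>Low-dimensional bar homology and 2-cocycles\<close>

lemma trivial_group_homology_cycles_subset:
  assumes "trivial_group (group_homology n G)"
  shows "bar_cycles n G \<subseteq> bar_boundaries n G"
proof
  fix c assume c: "c \<in> bar_cycles n G"
  let ?C = "subgroup_generated (bar_chain_group n G) (bar_cycles n G)"
  let ?B = "bar_boundaries n G"
  have "c \<in> carrier ?C"
    using c by (auto simp: carrier_subgroup_generated bar_cycles_def intro!: generate.incl)
  then have "?B #>\<^bsub>?C\<^esub> c \<in> carrier (group_homology n G)"
    by (auto simp: group_homology_def FactGroup_def RCOSETS_def)
  then have "?B #>\<^bsub>?C\<^esub> c = ?B"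
    using assms by (simp add: trivial_group_def group_homology_def FactGroup_def)
  moreover have "0 \<in> ?B"
    by (auto simp: bar_boundaries_def bar_boundary_def bar_chain_group_def intro!: image_eqI[of _ _ 0])
  then have "c \<in> ?B #>\<^bsub>?C\<^esub> c"
    by (force simp: r_coset_def bar_chain_group_def)
  ultimately show "c \<in> ?B" by simp
qed

lemma bar_boundary_diff:
  "bar_boundary G n (a - b) = bar_boundary G n a - bar_boundary G n b"
  by (simp add: bar_boundary_def frag_extend_diff)

lemma bar_boundary_1: "bar_boundary G 1 (frag_of [g]) = 0"
  by (simp add: bar_boundary_def bar_face_def)

lemma bar_boundary_2:
  "bar_boundary G 2 (frag_of [g, h]) = frag_of [h] - frag_of [g \<otimes>\<^bsub>G\<^esub> h] + frag_of [g]"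
  by (simp add: bar_boundary_def bar_face_def numeral_2_eq_2)

lemma bar_boundary_3:
  "bar_boundary G 3 (frag_of [g, h, k]) =
    frag_of [h, k] - frag_of [g \<otimes>\<^bsub>G\<^esub> h, k] + frag_of [g, h \<otimes>\<^bsub>G\<^esub> k] - frag_of [g, h]"
  by (simp add: bar_boundary_def bar_face_def numeral_3_eq_3)

text \<open>No injectivity of the coefficients is needed: a cocycle \<open>c\<close> extends to a homomorphism on the
  2-chains that vanishes on boundaries, hence, as \<open>H\<^sub>2 = 0\<close>, on cycles. It therefore
  factors through the boundary map to the 1-chains. All 1-chains are cycles, hence boundaries as \<open>H\<^sub>1 = 0\<close>, so the
  factorization is defined on every generator \<open>[g]\<close>, and its values there are the desired
  1-cochain.\<close>

lemma superperfect_cocycle_imp_coboundary: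
  assumes H: "superperfect H" and A: "comm_group A"
    and c: "\<And>g h. g \<in> carrier H \<Longrightarrow> h \<in> carrier H \<Longrightarrow> c g h \<in> carrier A"
    and cocycle: "\<And>g h k. g \<in> carrier H \<Longrightarrow> h \<in> carrier H \<Longrightarrow> k \<in> carrier H \<Longrightarrow>
      c h k \<otimes>\<^bsub>A\<^esub> c g (h \<otimes>\<^bsub>H\<^esub> k) = c (g \<otimes>\<^bsub>H\<^esub> h) k \<otimes>\<^bsub>A\<^esub> c g h"
  obtains \<phi> where "\<And>g. g \<in> carrier H \<Longrightarrow> \<phi> g \<in> carrier A"
    and "\<And>g h. g \<in> carrier H \<Longrightarrow> h \<in> carrier H \<Longrightarrow> c g h \<otimes>\<^bsub>A\<^esub> \<phi> (g \<otimes>\<^bsub>H\<^esub> h) = \<phi> g \<otimes>\<^bsub>A\<^esub> \<phi> h"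
proof -
  interpret H: group H using H by (simp add: superperfect_def)
  interpret A: comm_group A by (rule A)
  define S where "S n = {xs. length xs = n \<and> set xs \<subseteq> carrier H}" for n
  have chain: "bar_chain_group n H = free_Abelian_group (S n)" for n
    by (simp add: bar_chain_group_def S_def)
  have "(\<lambda>xs. c (xs ! 0) (xs ! 1)) ` S 2 \<subseteq> carrier A"
    using c by (auto simp: S_def numeral_2_eq_2 length_Suc_conv)
  then obtain F where F: "F \<in> hom (free_Abelian_group (S 2)) A"
    and F_of: "\<And>xs. xs \<in> S 2 \<Longrightarrow> F (frag_of xs) = c (xs ! 0) (xs ! 1)"
    using A.free_Abelian_group_universal by blast
  interpret F: group_hom "free_Abelian_group (S 2)" A F
    by (intro group_hom.intro group_hom_axioms.intro group_free_Abelian_group A.is_group F)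
  have Fgh: "F (frag_of [g, h]) = c g h" "Poly_Mapping.keys (frag_of [g, h]) \<subseteq> S 2"
    if "g \<in> carrier H" "h \<in> carrier H" for g h
    using F_of[of "[g, h]"] that by (auto simp: S_def)
  have add: "F (a + b) = F a \<otimes>\<^bsub>A\<^esub> F b \<and> Poly_Mapping.keys (a + b) \<subseteq> S 2"
    if "Poly_Mapping.keys a \<subseteq> S 2" "Poly_Mapping.keys b \<subseteq> S 2" for a b
    using that F.hom_mult[of a b] keys_add[of a b] by auto
  have diff: "F (a - b) = F a \<otimes>\<^bsub>A\<^esub> inv\<^bsub>A\<^esub> F b \<and> Poly_Mapping.keys (a - b) \<subseteq> S 2"
    if "Poly_Mapping.keys a \<subseteq> S 2" "Poly_Mapping.keys b \<subseteq> S 2" for a b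
    using that F.hom_mult[of a "-b"] F.hom_inv[of b] keys_diff[of a b] by auto
  have F0: "F 0 = \<one>\<^bsub>A\<^esub>" using F.hom_one by simp
  have Fc: "F a \<in> carrier A" if "Poly_Mapping.keys a \<subseteq> S 2" for a
    using that F.hom_closed[of a] by simp
  have boundary: "Poly_Mapping.keys (bar_boundary H 3 x) \<subseteq> S 2 \<and> F (bar_boundary H 3 x) = \<one>\<^bsub>A\<^esub>"
    if "Poly_Mapping.keys x \<subseteq> S 3" for x
    using that
  proof (induction x rule: free_Abelian_group_induct[consumes 1])
    case 1 show ?case by (simp add: bar_boundary_def F0)
  next
    case (2 x y) then show ?case using diff by (simp add: bar_boundary_diff)
  next
    case (3 xs)
    then obtain g h k where xs: "xs = [g, h, k]"
      and g: "g \<in> carrier H" and h: "h \<in> carrier H" and k: "k \<in> carrier H"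
      by (auto simp: S_def numeral_3_eq_3 length_Suc_conv)
    define a b d e where "a = frag_of [h, k]" and "b = frag_of [g \<otimes>\<^bsub>H\<^esub> h, k]"
      and "d = frag_of [g, h \<otimes>\<^bsub>H\<^esub> k]" and "e = frag_of [g, h]"
    have ks: "Poly_Mapping.keys a \<subseteq> S 2" "Poly_Mapping.keys b \<subseteq> S 2"
        "Poly_Mapping.keys d \<subseteq> S 2" "Poly_Mapping.keys e \<subseteq> S 2"
      unfolding a_def b_def d_def e_def using g h k by (auto simp: S_def)
    have Fs: "F a = c h k" "F b = c (g \<otimes>\<^bsub>H\<^esub> h) k" "F d = c g (h \<otimes>\<^bsub>H\<^esub> k)" "F e = c g h"
      unfolding a_def b_def d_def e_def using g h k by (auto intro!: Fgh(1))
    have "F (a - b + d - e) = F a \<otimes>\<^bsub>A\<^esub> inv\<^bsub>A\<^esub> F b \<otimes>\<^bsub>A\<^esub> F d \<otimes>\<^bsub>A\<^esub> inv\<^bsub>A\<^esub> F e \<and>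
        Poly_Mapping.keys (a - b + d - e) \<subseteq> S 2"
      using ks add diff by presburger
    moreover have "F a \<otimes>\<^bsub>A\<^esub> inv\<^bsub>A\<^esub> F b \<otimes>\<^bsub>A\<^esub> F d \<otimes>\<^bsub>A\<^esub> inv\<^bsub>A\<^esub> F e =
        (F a \<otimes>\<^bsub>A\<^esub> F d) \<otimes>\<^bsub>A\<^esub> inv\<^bsub>A\<^esub> (F b \<otimes>\<^bsub>A\<^esub> F e)"
      using ks Fc by (simp add: A.inv_mult A.m_ac)
    moreover have "F a \<otimes>\<^bsub>A\<^esub> F d = F b \<otimes>\<^bsub>A\<^esub> F e" using cocycle[OF g h k] by (simp add: Fs)
    ultimately show ?case using ks Fc
      by (simp add: xs bar_boundary_3 flip: a_def b_def d_def e_def)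
  qed
  have cycle: "F z = \<one>\<^bsub>A\<^esub>" if "Poly_Mapping.keys z \<subseteq> S 2" "bar_boundary H 2 z = 0" for z
  proof -
    have "z \<in> bar_cycles 2 H" using that by (simp add: bar_cycles_def chain)
    then have "z \<in> bar_boundaries 2 H"
      using H trivial_group_homology_cycles_subset by (auto simp: superperfect_def)
    then show ?thesis using boundary by (auto simp: bar_boundaries_def chain)
  qed
  have "\<exists>e. Poly_Mapping.keys e \<subseteq> S 2 \<and> bar_boundary H 2 e = frag_of [g]" if "g \<in> carrier H" for g
  proof -
    have "frag_of [g] \<in> bar_cycles 1 H"
      using that bar_boundary_1[of H g] by (simp add: bar_cycles_def chain S_def)
    then have "frag_of [g] \<in> bar_boundaries 1 H"
      using H trivial_group_homology_cycles_subset by (auto simp: superperfect_def)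
    then have "frag_of [g] \<in> bar_boundary H 2 ` carrier (bar_chain_group 2 H)"
      unfolding bar_boundaries_def one_add_one .
    then obtain e where "e \<in> carrier (bar_chain_group 2 H)" "frag_of [g] = bar_boundary H 2 e"
      by (rule imageE)
    then show ?thesis by (intro exI[of _ e]) (simp add: chain)
  qed
  \<comment> \<open>The 1-cochain is \<open>F \<circ> e\<close>; by the vanishing of \<open>F\<close> on cycles it does not depend on the choice of \<open>e\<close>.\<close>
  then obtain e where e: "\<And>g. g \<in> carrier H \<Longrightarrow> Poly_Mapping.keys (e g) \<subseteq> S 2"
      "\<And>g. g \<in> carrier H \<Longrightarrow> bar_boundary H 2 (e g) = frag_of [g]"
    by metis
  show thesis
  proof
    show "F (e g) \<in> carrier A" if "g \<in> carrier H" for g using Fc e that by blast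
    fix g h assume g: "g \<in> carrier H" and h: "h \<in> carrier H"
    have gh: "g \<otimes>\<^bsub>H\<^esub> h \<in> carrier H" using g h by simp
    define f where "f = frag_of [g, h]"
    have f: "F f = c g h" "Poly_Mapping.keys f \<subseteq> S 2"
      using Fgh[OF g h] by (simp_all add: f_def)
    note ks = e(1)[OF g] e(1)[OF h] e(1)[OF gh] f(2)
    have "F ((e g - f) - (e (g \<otimes>\<^bsub>H\<^esub> h) - e h)) =
        (F (e g) \<otimes>\<^bsub>A\<^esub> inv\<^bsub>A\<^esub> F f) \<otimes>\<^bsub>A\<^esub> inv\<^bsub>A\<^esub> (F (e (g \<otimes>\<^bsub>H\<^esub> h)) \<otimes>\<^bsub>A\<^esub> inv\<^bsub>A\<^esub> F (e h)) \<and>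
        Poly_Mapping.keys ((e g - f) - (e (g \<otimes>\<^bsub>H\<^esub> h) - e h)) \<subseteq> S 2"
      using ks diff by presburger
    moreover have "bar_boundary H 2 ((e g - f) - (e (g \<otimes>\<^bsub>H\<^esub> h) - e h)) = 0"
      using e(2)[OF g] e(2)[OF h] e(2)[OF gh]
      by (simp add: bar_boundary_diff f_def bar_boundary_2)
    ultimately have "(F (e g) \<otimes>\<^bsub>A\<^esub> inv\<^bsub>A\<^esub> F f) \<otimes>\<^bsub>A\<^esub>
        inv\<^bsub>A\<^esub> (F (e (g \<otimes>\<^bsub>H\<^esub> h)) \<otimes>\<^bsub>A\<^esub> inv\<^bsub>A\<^esub> F (e h)) = \<one>\<^bsub>A\<^esub>"
      using cycle by metis
    moreover have "(F (e g) \<otimes>\<^bsub>A\<^esub> inv\<^bsub>A\<^esub> F f) \<otimes>\<^bsub>A\<^esub>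
        inv\<^bsub>A\<^esub> (F (e (g \<otimes>\<^bsub>H\<^esub> h)) \<otimes>\<^bsub>A\<^esub> inv\<^bsub>A\<^esub> F (e h)) =
        (F (e g) \<otimes>\<^bsub>A\<^esub> F (e h)) \<otimes>\<^bsub>A\<^esub> inv\<^bsub>A\<^esub> (F f \<otimes>\<^bsub>A\<^esub> F (e (g \<otimes>\<^bsub>H\<^esub> h)))"
      using ks Fc by (simp add: A.inv_mult A.m_ac)
    ultimately have "(F (e g) \<otimes>\<^bsub>A\<^esub> F (e h)) \<otimes>\<^bsub>A\<^esub> inv\<^bsub>A\<^esub> (F f \<otimes>\<^bsub>A\<^esub> F (e (g \<otimes>\<^bsub>H\<^esub> h))) = \<one>\<^bsub>A\<^esub>"
      by simp
    then have "F (e g) \<otimes>\<^bsub>A\<^esub> F (e h) = F f \<otimes>\<^bsub>A\<^esub> F (e (g \<otimes>\<^bsub>H\<^esub> h))"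
      using ks Fc
        A.inv_equality[of "F (e g) \<otimes>\<^bsub>A\<^esub> F (e h)" "inv\<^bsub>A\<^esub> (F f \<otimes>\<^bsub>A\<^esub> F (e (g \<otimes>\<^bsub>H\<^esub> h)))"]
      by simp
    then show "c g h \<otimes>\<^bsub>A\<^esub> F (e (g \<otimes>\<^bsub>H\<^esub> h)) = F (e g) \<otimes>\<^bsub>A\<^esub> F (e h)"
      using f by simp
  qed
qed

section \<open>Lifting homomorphisms along central extensions\<close>

lemma superperfect_lift:
  assumes H: "superperfect H" and E: "central_extension E G q" and u: "u \<in> hom H G"
  obtains f where "f \<in> Hom H E" "\<And>x. x \<in> carrier H \<Longrightarrow> q (f x) = u x"
proof -
  interpret H: group H using H by (simp add: superperfect_def)
  interpret E: group E using E by (simp add: central_extension_def)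
  interpret G: group G using E by (simp add: central_extension_def)
  have q: "q \<in> hom E G" and qsurj: "q ` carrier E = carrier G"
    using E by (auto simp: central_extension_def epi_def)
  interpret q: group_hom E G q using q by unfold_locales
  interpret u: group_hom H G u using u by unfold_locales
  let ?K = "kernel E G q"
  have K: "z \<in> ?K \<longleftrightarrow> z \<in> carrier E \<and> q z = \<one>\<^bsub>G\<^esub>" for z by (simp add: kernel_def)
  have central: "z \<otimes>\<^bsub>E\<^esub> x = x \<otimes>\<^bsub>E\<^esub> z" if "z \<in> ?K" "x \<in> carrier E" for z x
    using E that by (simp add: central_extension_def)
  define A where "A = E\<lparr>carrier := ?K\<rparr>"
  have subK: "subgroup ?K E" by (rule q.subgroup_kernel)
  have A: "comm_group A"
    unfolding A_def using central K
    by (intro group.group_comm_groupI E.subgroup_imp_group[OF subK]) auto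
  \<comment> \<open>\<open>s\<close> is a lift of \<open>u\<close> as a map of sets, and \<open>c\<close> is its failure to be multiplicative.\<close>
  define s where "s g = inv_into (carrier E) q (u g)" for g
  have s: "s g \<in> carrier E" "q (s g) = u g" if "g \<in> carrier H" for g
  proof -
    have "u g \<in> q ` carrier E" using that qsurj by simp
    then show "s g \<in> carrier E" "q (s g) = u g"
      unfolding s_def by (auto intro: inv_into_into f_inv_into_f)
  qed
  define c where "c g h = s g \<otimes>\<^bsub>E\<^esub> s h \<otimes>\<^bsub>E\<^esub> inv\<^bsub>E\<^esub> s (g \<otimes>\<^bsub>H\<^esub> h)" for g h
  have c: "c g h \<in> ?K" if "g \<in> carrier H" "h \<in> carrier H" for g h
    using that s by (simp add: K c_def)
  have cE: "c g h \<in> carrier E" if "g \<in> carrier H" "h \<in> carrier H" for g h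
    using c[OF that] K by simp
  have ss: "s g \<otimes>\<^bsub>E\<^esub> s h = c g h \<otimes>\<^bsub>E\<^esub> s (g \<otimes>\<^bsub>H\<^esub> h)" if "g \<in> carrier H" "h \<in> carrier H" for g h
    using that s by (simp add: c_def E.m_assoc)
  have cocycle: "c h k \<otimes>\<^bsub>E\<^esub> c g (h \<otimes>\<^bsub>H\<^esub> k) = c (g \<otimes>\<^bsub>H\<^esub> h) k \<otimes>\<^bsub>E\<^esub> c g h"
    if g: "g \<in> carrier H" and h: "h \<in> carrier H" and k: "k \<in> carrier H" for g h k
  proof -
    \<comment> \<open>Both products of cocycle values compare the same threefold product of values of \<open>s\<close> with \<open>?t\<close>.\<close>
    let ?t = "s (g \<otimes>\<^bsub>H\<^esub> h \<otimes>\<^bsub>H\<^esub> k)"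
    have "s g \<otimes>\<^bsub>E\<^esub> (s h \<otimes>\<^bsub>E\<^esub> s k) = (s g \<otimes>\<^bsub>E\<^esub> c h k) \<otimes>\<^bsub>E\<^esub> s (h \<otimes>\<^bsub>H\<^esub> k)"
      using g h k s(1) cE by (simp add: ss[OF h k] E.m_assoc)
    also have "s g \<otimes>\<^bsub>E\<^esub> c h k = c h k \<otimes>\<^bsub>E\<^esub> s g"
      using central[OF c[OF h k] s(1)[OF g]] by simp
    also have "c h k \<otimes>\<^bsub>E\<^esub> s g \<otimes>\<^bsub>E\<^esub> s (h \<otimes>\<^bsub>H\<^esub> k) =
        c h k \<otimes>\<^bsub>E\<^esub> c g (h \<otimes>\<^bsub>H\<^esub> k) \<otimes>\<^bsub>E\<^esub> ?t"
      using g h k s(1) cE by (simp add: ss E.m_assoc H.m_assoc)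
    finally have 1: "s g \<otimes>\<^bsub>E\<^esub> (s h \<otimes>\<^bsub>E\<^esub> s k) = c h k \<otimes>\<^bsub>E\<^esub> c g (h \<otimes>\<^bsub>H\<^esub> k) \<otimes>\<^bsub>E\<^esub> ?t" .
    have "s g \<otimes>\<^bsub>E\<^esub> s h \<otimes>\<^bsub>E\<^esub> s k = c g h \<otimes>\<^bsub>E\<^esub> (s (g \<otimes>\<^bsub>H\<^esub> h) \<otimes>\<^bsub>E\<^esub> s k)"
      using g h k s cE by (simp add: ss[OF g h] E.m_assoc)
    also have "\<dots> = c g h \<otimes>\<^bsub>E\<^esub> c (g \<otimes>\<^bsub>H\<^esub> h) k \<otimes>\<^bsub>E\<^esub> ?t"
      using g h k s cE by (simp add: ss E.m_assoc)
    also have "c g h \<otimes>\<^bsub>E\<^esub> c (g \<otimes>\<^bsub>H\<^esub> h) k = c (g \<otimes>\<^bsub>H\<^esub> h) k \<otimes>\<^bsub>E\<^esub> c g h"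
      using g h k c cE by (intro central) auto
    finally have 2: "s g \<otimes>\<^bsub>E\<^esub> s h \<otimes>\<^bsub>E\<^esub> s k = c (g \<otimes>\<^bsub>H\<^esub> h) k \<otimes>\<^bsub>E\<^esub> c g h \<otimes>\<^bsub>E\<^esub> ?t" .
    have "c h k \<otimes>\<^bsub>E\<^esub> c g (h \<otimes>\<^bsub>H\<^esub> k) \<otimes>\<^bsub>E\<^esub> ?t = c (g \<otimes>\<^bsub>H\<^esub> h) k \<otimes>\<^bsub>E\<^esub> c g h \<otimes>\<^bsub>E\<^esub> ?t"
      using 1 2 g h k s by (simp add: E.m_assoc)
    then show ?thesis using g h k s(1) cE by (simp add: E.right_cancel)
  qed
  obtain \<phi> where \<phi>: "\<And>g. g \<in> carrier H \<Longrightarrow> \<phi> g \<in> ?K"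
    and \<phi>_mult: "\<And>g h. g \<in> carrier H \<Longrightarrow> h \<in> carrier H \<Longrightarrow>
      c g h \<otimes>\<^bsub>E\<^esub> \<phi> (g \<otimes>\<^bsub>H\<^esub> h) = \<phi> g \<otimes>\<^bsub>E\<^esub> \<phi> h"
    using superperfect_cocycle_imp_coboundary[OF H A, of c] c cocycle unfolding A_def by auto
  have \<phi>E: "\<phi> g \<in> carrier E" and q\<phi>: "q (\<phi> g) = \<one>\<^bsub>G\<^esub>" if "g \<in> carrier H" for g
    using \<phi>[OF that] K by auto
  define t where "t g = inv\<^bsub>E\<^esub> \<phi> g \<otimes>\<^bsub>E\<^esub> s g" for g
  have tE: "t g \<in> carrier E" and qt: "q (t g) = u g" if "g \<in> carrier H" for g
    using that s \<phi>E q\<phi> by (auto simp: t_def)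
  have st: "s g = \<phi> g \<otimes>\<^bsub>E\<^esub> t g" if "g \<in> carrier H" for g
    using that s \<phi>E by (simp add: t_def flip: E.m_assoc)
  have "t (g \<otimes>\<^bsub>H\<^esub> h) = t g \<otimes>\<^bsub>E\<^esub> t h" if g: "g \<in> carrier H" and h: "h \<in> carrier H" for g h
  proof -
    have gh: "g \<otimes>\<^bsub>H\<^esub> h \<in> carrier H" using g h by simp
    have "\<phi> g \<otimes>\<^bsub>E\<^esub> \<phi> h \<otimes>\<^bsub>E\<^esub> (t g \<otimes>\<^bsub>E\<^esub> t h) = \<phi> g \<otimes>\<^bsub>E\<^esub> (\<phi> h \<otimes>\<^bsub>E\<^esub> t g) \<otimes>\<^bsub>E\<^esub> t h"
      using g h \<phi>E tE by (simp add: E.m_assoc)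
    also have "\<phi> h \<otimes>\<^bsub>E\<^esub> t g = t g \<otimes>\<^bsub>E\<^esub> \<phi> h" by (rule central[OF \<phi>[OF h] tE[OF g]])
    also have "\<phi> g \<otimes>\<^bsub>E\<^esub> (t g \<otimes>\<^bsub>E\<^esub> \<phi> h) \<otimes>\<^bsub>E\<^esub> t h = s g \<otimes>\<^bsub>E\<^esub> s h"
      using g h \<phi>E tE by (simp add: st E.m_assoc)
    also have "\<dots> = c g h \<otimes>\<^bsub>E\<^esub> (\<phi> (g \<otimes>\<^bsub>H\<^esub> h) \<otimes>\<^bsub>E\<^esub> t (g \<otimes>\<^bsub>H\<^esub> h))"
      unfolding ss[OF g h] st[OF gh] ..
    also have "\<dots> = \<phi> g \<otimes>\<^bsub>E\<^esub> \<phi> h \<otimes>\<^bsub>E\<^esub> t (g \<otimes>\<^bsub>H\<^esub> h)"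
      using g h gh \<phi>E tE cE by (simp add: \<phi>_mult flip: E.m_assoc)
    finally show ?thesis using g h gh \<phi>E tE by simp
  qed
  then have "restrict t (carrier H) \<in> Hom H E"
    using tE by (auto simp: Hom_def hom_def)
  then show thesis using that[of "restrict t (carrier H)"] qt by simp
qed

text \<open>Every homomorphism from \<open>A\<close> to \<open>B\<close> whose image is commutative is trivial. If \<open>A\<close> is perfect,
  this holds for all \<open>B\<close>; fixing \<open>B\<close> avoids a quantification over types. Only elements of the
  image are required to commute, so that \<open>B\<close> itself need not be abelian.\<close>

definition no_abelian_image :: "('a, 'x) monoid_scheme \<Rightarrow> ('b, 'y) monoid_scheme \<Rightarrow> bool"
  where "no_abelian_image A B \<longleftrightarrow>
    (\<forall>d \<in> hom A B. (\<forall>x \<in> carrier A. \<forall>y \<in> carrier A. d x \<otimes>\<^bsub>B\<^esub> d y = d y \<otimes>\<^bsub>B\<^esub> d x) \<longrightarrow>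
      (\<forall>x \<in> carrier A. d x = \<one>\<^bsub>B\<^esub>))"

lemma simple_group_no_abelian_image:
  assumes H: "simple_group H" and nc: "\<not> comm_group H" and B: "group B"
  shows "no_abelian_image H B"
  unfolding no_abelian_image_def
proof (intro ballI impI)
  fix d x
  assume d: "d \<in> hom H B" and x: "x \<in> carrier H"
    and comm: "\<forall>x \<in> carrier H. \<forall>y \<in> carrier H. d x \<otimes>\<^bsub>B\<^esub> d y = d y \<otimes>\<^bsub>B\<^esub> d x"
  interpret H: simple_group H by (rule H)
  interpret B: group B by (rule B)
  interpret d: group_hom H B d using d by unfold_locales
  have "kernel H B d \<noteq> {\<one>\<^bsub>H\<^esub>}"
  proof
    assume "kernel H B d = {\<one>\<^bsub>H\<^esub>}"
    then have "inj_on d (carrier H)" by (rule d.trivial_ker_imp_inj)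
    then have "y \<otimes>\<^bsub>H\<^esub> z = z \<otimes>\<^bsub>H\<^esub> y" if "y \<in> carrier H" "z \<in> carrier H" for y z
      using comm that by (auto dest!: inj_onD[where x = "y \<otimes>\<^bsub>H\<^esub> z" and y = "z \<otimes>\<^bsub>H\<^esub> y"])
    then show False using nc H.group_comm_groupI by blast
  qed
  then have "kernel H B d = carrier H"
    using H.no_real_normal_subgroup[OF d.normal_kernel] by blast
  then show "d x = \<one>\<^bsub>B\<^esub>" using x by (auto simp: kernel_def)
qed

text \<open>If \<open>d\<close> has commutative image \<open>D\<close>, then \<open>G \<times> D\<close> is a central extension of \<open>G\<close> in which both
  \<open>x \<mapsto> (q x, d x)\<close> and \<open>x \<mapsto> (q x, 1)\<close> are lifts of \<open>q\<close>; they agree by uniqueness.\<close>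

lemma universal_central_extension_no_abelian_image:
  assumes U: "universal_central_extension E G q" and B: "group B"
  shows "no_abelian_image E B"
  unfolding no_abelian_image_def
proof (intro ballI impI)
  fix d x
  assume d: "d \<in> hom E B" and x: "x \<in> carrier E"
    and comm: "\<forall>x \<in> carrier E. \<forall>y \<in> carrier E. d x \<otimes>\<^bsub>B\<^esub> d y = d y \<otimes>\<^bsub>B\<^esub> d x"
  have C: "central_extension E G q" using U by (simp add: universal_central_extension_def)
  interpret E: group E using C by (simp add: central_extension_def)
  interpret G: group G using C by (simp add: central_extension_def)
  interpret B: group B by (rule B)
  interpret d: group_hom E B d using d by unfold_locales
  have q: "q \<in> hom E G" using C by (simp add: central_extension_def epi_def)
  define D where "D = B\<lparr>carrier := d ` carrier E\<rparr>"
  have D: "group D" unfolding D_def using d.img_is_subgroup B.subgroup_imp_group by blast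
  define P where "P = G \<times>\<times> D"
  have cP: "carrier P = carrier G \<times> d ` carrier E" by (simp add: P_def D_def)
  have multP: "u \<otimes>\<^bsub>P\<^esub> v = (fst u \<otimes>\<^bsub>G\<^esub> fst v, snd u \<otimes>\<^bsub>B\<^esub> snd v)" for u v
    by (simp add: P_def D_def DirProd_def split: prod.split)
  have one: "\<one>\<^bsub>B\<^esub> \<in> d ` carrier E" using d.hom_one E.one_closed by (metis image_eqI)
  have P: "group P" unfolding P_def using D G.is_group by (rule DirProd_group[rotated])
  have "fst \<in> epi P G"
    using one by (auto simp: epi_def hom_def cP multP image_iff)
  moreover have "z \<otimes>\<^bsub>P\<^esub> y = y \<otimes>\<^bsub>P\<^esub> z" if "z \<in> kernel P G fst" "y \<in> carrier P" for z y
    using that comm by (auto simp: kernel_def cP multP)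
  ultimately have CP: "central_extension P G fst"
    using P G.is_group unfolding central_extension_def by blast
  have homs: "(\<lambda>y. (q y, d y)) \<in> hom E P" "(\<lambda>y. (q y, \<one>\<^bsub>B\<^esub>)) \<in> hom E P"
    using one q by (auto simp: hom_def cP multP Pi_iff)
  have "(q x, d x) = (q x, \<one>\<^bsub>B\<^esub>)"
    using universal_central_extension_unique[OF U CP homs(1) _ homs(2) _ x] by simp
  then show "d x = \<one>\<^bsub>B\<^esub>" by simp
qed

lemma central_extension_lifts_eq:
  assumes C: "central_extension E G q" and A: "group A" and triv: "no_abelian_image A E"
    and f: "f \<in> hom A E" and g: "g \<in> hom A E"
    and eq: "\<And>x. x \<in> carrier A \<Longrightarrow> q (f x) = q (g x)"
    and x: "x \<in> carrier A"
  shows "f x = g x"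
proof -
  interpret A: group A by (rule A)
  interpret E: group E using C by (simp add: central_extension_def)
  interpret G: group G using C by (simp add: central_extension_def)
  interpret f: group_hom A E f using f by unfold_locales
  interpret g: group_hom A E g using g by unfold_locales
  have "q \<in> hom E G" using C by (simp add: central_extension_def epi_def)
  then interpret q: group_hom E G q by unfold_locales
  \<comment> \<open>The quotient of two lifts takes values in the central kernel, hence is a homomorphism.\<close>
  define d where "d y = f y \<otimes>\<^bsub>E\<^esub> inv\<^bsub>E\<^esub> g y" for y
  have dc: "d y \<in> carrier E" if "y \<in> carrier A" for y using that by (simp add: d_def)
  have central: "d y \<otimes>\<^bsub>E\<^esub> z = z \<otimes>\<^bsub>E\<^esub> d y" if "y \<in> carrier A" "z \<in> carrier E" for y z
    using C that eq by (auto simp: central_extension_def kernel_def d_def)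
  have "d (y \<otimes>\<^bsub>A\<^esub> z) = d y \<otimes>\<^bsub>E\<^esub> d z" if y: "y \<in> carrier A" and z: "z \<in> carrier A" for y z
  proof -
    have "d (y \<otimes>\<^bsub>A\<^esub> z) = f y \<otimes>\<^bsub>E\<^esub> (d z \<otimes>\<^bsub>E\<^esub> inv\<^bsub>E\<^esub> g y)"
      using y z by (simp add: d_def E.inv_mult_group E.m_assoc)
    also have "\<dots> = f y \<otimes>\<^bsub>E\<^esub> (inv\<^bsub>E\<^esub> g y \<otimes>\<^bsub>E\<^esub> d z)" using central y z by simp
    also have "\<dots> = d y \<otimes>\<^bsub>E\<^esub> d z" using y z dc[OF z] by (simp add: d_def E.m_assoc)
    finally show ?thesis .
  qed
  then have "d \<in> hom A E" using dc by (auto simp: hom_def)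
  moreover have "\<forall>y \<in> carrier A. \<forall>z \<in> carrier A. d y \<otimes>\<^bsub>E\<^esub> d z = d z \<otimes>\<^bsub>E\<^esub> d y"
    using central dc by blast
  ultimately have "d x = \<one>\<^bsub>E\<^esub>" using triv x unfolding no_abelian_image_def by blast
  then show ?thesis using x E.inv_equality[of "f x" "inv\<^bsub>E\<^esub> g x"] by (simp add: d_def)
qed

lemma bij_betw_Hom_central_extension:
  assumes C: "central_extension E G q" and A: "group A" and triv: "no_abelian_image A E"
    and lift: "\<And>u. u \<in> hom A G \<Longrightarrow> \<exists>f \<in> hom A E. \<forall>x \<in> carrier A. q (f x) = u x"
  shows "bij_betw (compose (carrier A) q) (Hom A E) (Hom A G)"
  unfolding bij_betw_def
proof (intro conjI equalityI subsetI)
  have q: "q \<in> hom E G" using C by (simp add: central_extension_def epi_def)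
  show "inj_on (compose (carrier A) q) (Hom A E)"
  proof (rule inj_onI)
    fix f g assume f: "f \<in> Hom A E" and g: "g \<in> Hom A E"
      and eq: "compose (carrier A) q f = compose (carrier A) q g"
    have "q (f x) = q (g x)" if "x \<in> carrier A" for x
      using fun_cong[OF eq, of x] that by (simp add: compose_def)
    then show "f = g"
      using f g central_extension_lifts_eq[OF C A triv, of f g]
      by (intro extensionalityI[of _ "carrier A"]) (auto simp: Hom_def)
  qed
  fix u
  show "u \<in> Hom A G" if "u \<in> compose (carrier A) q ` Hom A E"
    using that q A by (auto simp: Hom_def hom_def compose_def Pi_iff group.is_monoid monoid.m_closed)
  show "u \<in> compose (carrier A) q ` Hom A E" if u: "u \<in> Hom A G"
  proof -
    obtain f where f: "f \<in> hom A E" "\<forall>x \<in> carrier A. q (f x) = u x"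
      using lift u by (auto simp: Hom_def)
    have "u = compose (carrier A) q (restrict f (carrier A))"
      using f u by (intro extensionalityI[of _ "carrier A"]) (auto simp: Hom_def compose_def)
    moreover have "restrict f (carrier A) \<in> Hom A E"
      using f A by (auto simp: Hom_def hom_def group.is_monoid monoid.m_closed)
    ultimately show ?thesis by blast
  qed
qed

text \<open>The competing central extension is the pullback of \<open>q'\<close> along \<open>g\<close>.\<close>

lemma universal_central_extension_functorial:
  assumes U: "universal_central_extension E G q" and C: "central_extension E' G' q'"
    and g: "g \<in> hom G G'"
  shows "\<exists>f \<in> hom E E'. \<forall>x \<in> carrier E. q' (f x) = g (q x)"
proof -
  interpret G: group G
    using U by (simp add: universal_central_extension_def central_extension_def)
  interpret G': group G' using C by (simp add: central_extension_def)
  interpret E': group E' using C by (simp add: central_extension_def)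
  interpret g: group_hom G G' g using g by unfold_locales
  have q': "q' \<in> hom E' G'" and surj: "q' ` carrier E' = carrier G'"
    using C by (auto simp: central_extension_def epi_def)
  interpret q': group_hom E' G' q' using q' by unfold_locales
  define S where "S = {(a, y). a \<in> carrier G \<and> y \<in> carrier E' \<and> g a = q' y}"
  define P where "P = (G \<times>\<times> E')\<lparr>carrier := S\<rparr>"
  have multP: "u \<otimes>\<^bsub>P\<^esub> v = (fst u \<otimes>\<^bsub>G\<^esub> fst v, snd u \<otimes>\<^bsub>E'\<^esub> snd v)" for u v
    by (simp add: P_def DirProd_def split: prod.split)
  interpret GE: group "G \<times>\<times> E'" using G.is_group E'.is_group by (rule DirProd_group)
  have "subgroup S (G \<times>\<times> E')"
  proof (rule GE.subgroupI)
    have "(\<one>\<^bsub>G\<^esub>, \<one>\<^bsub>E'\<^esub>) \<in> S" by (simp add: S_def)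
    then show "S \<noteq> {}" by blast
  qed (auto simp: S_def inv_DirProd[OF G.is_group E'.is_group])
  then have P: "group P" unfolding P_def by (rule GE.subgroup_imp_group)
  have "fst ` S = carrier G"
  proof (intro equalityI subsetI)
    fix a assume a: "a \<in> carrier G"
    then have "g a \<in> q' ` carrier E'" using surj by simp
    then obtain y where "y \<in> carrier E'" "g a = q' y" by auto
    then have "(a, y) \<in> S" using a by (simp add: S_def)
    then show "a \<in> fst ` S" by force
  qed (auto simp: S_def)
  then have "fst \<in> epi P G" by (auto simp: epi_def hom_def multP) (auto simp: P_def S_def)
  moreover have "z \<otimes>\<^bsub>P\<^esub> y = y \<otimes>\<^bsub>P\<^esub> z" if "z \<in> kernel P G fst" "y \<in> carrier P" for z y
  proof -
    have "fst z = \<one>\<^bsub>G\<^esub>" "fst y \<in> carrier G" "snd y \<in> carrier E'" "snd z \<in> kernel E' G' q'"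
      using that by (auto simp: kernel_def P_def S_def)
    then show ?thesis using C by (simp add: multP central_extension_def)
  qed
  ultimately have "central_extension P G fst"
    using P G.is_group unfolding central_extension_def by blast
  then obtain f where f: "f \<in> Hom E P" "\<forall>x \<in> carrier E. fst (f x) = q x"
    using universal_central_extension_lift[OF U] by blast
  then have fS: "f x \<in> S" if "x \<in> carrier E" for x
    using that by (auto simp: Hom_def hom_def P_def)
  have "snd \<circ> f \<in> hom E E'"
  proof (rule homI)
    fix x y assume x: "x \<in> carrier E" and y: "y \<in> carrier E"
    show "(snd \<circ> f) x \<in> carrier E'" using fS[OF x] by (auto simp: S_def)
    have "f (x \<otimes>\<^bsub>E\<^esub> y) = f x \<otimes>\<^bsub>P\<^esub> f y" using f(1) x y by (simp add: Hom_def hom_mult)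
    then show "(snd \<circ> f) (x \<otimes>\<^bsub>E\<^esub> y) = (snd \<circ> f) x \<otimes>\<^bsub>E'\<^esub> (snd \<circ> f) y"
      by (simp add: multP)
  qed
  moreover have "q' (snd (f x)) = g (q x)" if "x \<in> carrier E" for x
    using fS[OF that] f(2) that by (auto simp: S_def)
  ultimately show ?thesis by (intro bexI[of _ "snd \<circ> f"]) auto
qed

section \<open>Homomorphisms from a central extension to a finite simple group\<close>

lemma simple_group_trivial_center:
  assumes G: "simple_group G" and nc: "\<not> comm_group G"
    and z: "z \<in> carrier G" "\<And>x. x \<in> carrier G \<Longrightarrow> z \<otimes>\<^bsub>G\<^esub> x = x \<otimes>\<^bsub>G\<^esub> z"
  shows "z = \<one>\<^bsub>G\<^esub>"
proof -
  interpret G: simple_group G by (rule G)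
  define Z where "Z = {z \<in> carrier G. \<forall>x \<in> carrier G. z \<otimes>\<^bsub>G\<^esub> x = x \<otimes>\<^bsub>G\<^esub> z}"
  have Z: "a \<in> carrier G" "\<And>x. x \<in> carrier G \<Longrightarrow> a \<otimes>\<^bsub>G\<^esub> x = x \<otimes>\<^bsub>G\<^esub> a" if "a \<in> Z" for a
    using that unfolding Z_def by blast+
  have ZI: "a \<in> Z" if "a \<in> carrier G" "\<And>x. x \<in> carrier G \<Longrightarrow> a \<otimes>\<^bsub>G\<^esub> x = x \<otimes>\<^bsub>G\<^esub> a" for a
    using that unfolding Z_def by blast
  have "subgroup Z G"
  proof (rule G.subgroupI)
    show "Z \<subseteq> carrier G" using Z(1) by blast
    have "\<one>\<^bsub>G\<^esub> \<in> Z" by (rule ZI) simp_all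
    then show "Z \<noteq> {}" by blast
    fix a assume a: "a \<in> Z"
    note aG = Z(1)[OF a]
    show "inv\<^bsub>G\<^esub> a \<in> Z"
    proof (rule ZI)
      fix x assume x: "x \<in> carrier G"
      have "inv\<^bsub>G\<^esub> a \<otimes>\<^bsub>G\<^esub> x = inv\<^bsub>G\<^esub> a \<otimes>\<^bsub>G\<^esub> (x \<otimes>\<^bsub>G\<^esub> a) \<otimes>\<^bsub>G\<^esub> inv\<^bsub>G\<^esub> a"
        using aG x by (simp add: G.m_assoc)
      also have "x \<otimes>\<^bsub>G\<^esub> a = a \<otimes>\<^bsub>G\<^esub> x" using Z(2)[OF a x] by (rule sym)
      also have "inv\<^bsub>G\<^esub> a \<otimes>\<^bsub>G\<^esub> (a \<otimes>\<^bsub>G\<^esub> x) \<otimes>\<^bsub>G\<^esub> inv\<^bsub>G\<^esub> a = x \<otimes>\<^bsub>G\<^esub> inv\<^bsub>G\<^esub> a"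
        using aG x by (simp flip: G.m_assoc)
      finally show "inv\<^bsub>G\<^esub> a \<otimes>\<^bsub>G\<^esub> x = x \<otimes>\<^bsub>G\<^esub> inv\<^bsub>G\<^esub> a" .
    qed (use aG in simp)
    fix b assume b: "b \<in> Z"
    note bG = Z(1)[OF b]
    show "a \<otimes>\<^bsub>G\<^esub> b \<in> Z"
    proof (rule ZI)
      fix x assume x: "x \<in> carrier G"
      have "a \<otimes>\<^bsub>G\<^esub> b \<otimes>\<^bsub>G\<^esub> x = a \<otimes>\<^bsub>G\<^esub> (x \<otimes>\<^bsub>G\<^esub> b)"
        using aG bG x by (simp add: G.m_assoc Z(2)[OF b x])
      also have "\<dots> = (a \<otimes>\<^bsub>G\<^esub> x) \<otimes>\<^bsub>G\<^esub> b" using aG bG x by (simp add: G.m_assoc)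
      also have "a \<otimes>\<^bsub>G\<^esub> x = x \<otimes>\<^bsub>G\<^esub> a" by (rule Z(2)[OF a x])
      also have "x \<otimes>\<^bsub>G\<^esub> a \<otimes>\<^bsub>G\<^esub> b = x \<otimes>\<^bsub>G\<^esub> (a \<otimes>\<^bsub>G\<^esub> b)" using aG bG x by (simp add: G.m_assoc)
      finally show "a \<otimes>\<^bsub>G\<^esub> b \<otimes>\<^bsub>G\<^esub> x = x \<otimes>\<^bsub>G\<^esub> (a \<otimes>\<^bsub>G\<^esub> b)" .
    qed (use aG bG in simp)
  qed
  moreover have "x \<otimes>\<^bsub>G\<^esub> a \<otimes>\<^bsub>G\<^esub> inv\<^bsub>G\<^esub> x \<in> Z" if x: "x \<in> carrier G" and a: "a \<in> Z" for x a
  proof -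
    have "x \<otimes>\<^bsub>G\<^esub> a \<otimes>\<^bsub>G\<^esub> inv\<^bsub>G\<^esub> x = a"
      using x Z(1)[OF a] by (simp add: G.m_assoc flip: Z(2)[OF a x])
    then show ?thesis using a by simp
  qed
  ultimately have "Z \<lhd> G" by (simp add: G.normal_inv_iff)
  moreover have "Z \<noteq> carrier G" using nc G.group_comm_groupI by (auto simp: Z_def)
  ultimately have "Z = {\<one>\<^bsub>G\<^esub>}" using G.no_real_normal_subgroup by blast
  then show ?thesis using z by (auto simp: Z_def)
qed

text \<open>Let \<open>N\<close> be the kernel of \<open>d\<close>. Its image under \<open>q\<close> is normal in \<open>G\<close>. If it is all of \<open>G\<close>, then
  \<open>E\<close> is the product of \<open>N\<close> and the central kernel of \<open>q\<close>, so \<open>d\<close> has commutative image and is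
  trivial. If it is trivial, then \<open>q\<close> factors through \<open>d\<close>; counting elements shows that \<open>d\<close> is
  onto, so \<open>d\<close> maps the central kernel of \<open>q\<close> into the trivial center of \<open>G\<close>.\<close>

lemma hom_to_finite_simple_group_kills_kernel:
  assumes G: "simple_group G" and fin: "finite (carrier G)" and nc: "\<not> comm_group G"
    and C: "central_extension E G q" and triv: "no_abelian_image E G"
    and d: "d \<in> hom E G" and z: "z \<in> kernel E G q"
  shows "d z = \<one>\<^bsub>G\<^esub>"
proof -
  interpret G: simple_group G by (rule G)
  interpret E: group E using C by (simp add: central_extension_def)
  have q: "q \<in> hom E G" and surj: "q ` carrier E = carrier G"
    using C by (auto simp: central_extension_def epi_def)
  interpret q: group_hom E G q using q by unfold_locales
  interpret d: group_hom E G d using d by unfold_locales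
  let ?N = "kernel E G d"
  have zE: "z \<in> carrier E" using z by (simp add: kernel_def)
  have central: "k \<otimes>\<^bsub>E\<^esub> x = x \<otimes>\<^bsub>E\<^esub> k" if "k \<in> kernel E G q" "x \<in> carrier E" for k x
    using C that unfolding central_extension_def by blast
  have "q ` ?N \<lhd> G"
    using normal.surj_hom_normal_subgroup[OF d.normal_kernel q.group_hom_axioms surj] .
  then consider "q ` ?N = carrier G" | "q ` ?N = {\<one>\<^bsub>G\<^esub>}"
    using G.no_real_normal_subgroup by blast
  then show ?thesis
  proof cases
    case 1
    have "d x \<otimes>\<^bsub>G\<^esub> d y = d y \<otimes>\<^bsub>G\<^esub> d x" if x: "x \<in> carrier E" and y: "y \<in> carrier E" for x y
    proof -
      have "q x \<in> q ` ?N" using 1 x by simp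
      then obtain n where n: "n \<in> carrier E" "d n = \<one>\<^bsub>G\<^esub>" "q n = q x" by (auto simp: kernel_def)
      define k where "k = inv\<^bsub>E\<^esub> n \<otimes>\<^bsub>E\<^esub> x"
      have k: "k \<in> kernel E G q" "k \<in> carrier E" using n x by (simp_all add: k_def kernel_def)
      have "d k = d x" using n x by (simp add: k_def)
      then show ?thesis using k y central[OF k(1) y] by (metis d.hom_mult)
    qed
    then show ?thesis using triv d zE by (simp add: no_abelian_image_def)
  next
    case 2
    have qd: "q x = q y" if x: "x \<in> carrier E" and y: "y \<in> carrier E" and eq: "d x = d y" for x y
    proof -
      have "x \<otimes>\<^bsub>E\<^esub> inv\<^bsub>E\<^esub> y \<in> ?N" using x y eq by (simp add: kernel_def)
      then have "q (x \<otimes>\<^bsub>E\<^esub> inv\<^bsub>E\<^esub> y) = \<one>\<^bsub>G\<^esub>" using 2 by blast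
      then show ?thesis using x y G.inv_equality[of "q x" "inv\<^bsub>G\<^esub> q y"] by simp
    qed
    have "q (inv_into (carrier E) d (d x)) = q x" if "x \<in> carrier E" for x
      using that by (intro qd) (auto intro: inv_into_into f_inv_into_f)
    then have "(\<lambda>a. q (inv_into (carrier E) d a)) ` d ` carrier E = carrier G"
      unfolding surj[symmetric] image_image by (rule image_cong[OF refl])
    moreover have sub: "d ` carrier E \<subseteq> carrier G" by auto
    ultimately have "card (carrier G) \<le> card (d ` carrier E)"
      using card_image_le finite_subset[OF sub fin] by metis
    then have dsurj: "d ` carrier E = carrier G"
      using sub fin by (simp add: card_seteq)
    show ?thesis
    proof (rule simple_group_trivial_center[OF G nc])
      fix a assume "a \<in> carrier G"
      then obtain x where x: "x \<in> carrier E" "a = d x" using dsurj by auto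
      then show "d z \<otimes>\<^bsub>G\<^esub> a = a \<otimes>\<^bsub>G\<^esub> d z"
        using central[OF z x(1)] zE by (metis d.hom_mult)
    qed (use zE in simp)
  qed
qed

lemma bij_betw_Hom_precompose_epi:
  assumes E: "group E" and G: "group G" and B: "group B" and q: "q \<in> epi E G"
    and kills: "\<And>d z. d \<in> hom E B \<Longrightarrow> z \<in> kernel E G q \<Longrightarrow> d z = \<one>\<^bsub>B\<^esub>"
  shows "bij_betw (\<lambda>f. compose (carrier E) f q) (Hom G B) (Hom E B)"
  unfolding bij_betw_def
proof (intro conjI equalityI subsetI)
  interpret E: group E by (rule E)
  interpret G: group G by (rule G)
  interpret B: group B by (rule B)
  have qh: "q \<in> hom E G" and surj: "q ` carrier E = carrier G" using q by (auto simp: epi_def)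
  interpret q: group_hom E G q using qh by unfold_locales
  show "inj_on (\<lambda>f. compose (carrier E) f q) (Hom G B)"
  proof (rule inj_onI)
    fix f g assume f: "f \<in> Hom G B" and g: "g \<in> Hom G B"
      and eq: "compose (carrier E) f q = compose (carrier E) g q"
    have "f (q x) = g (q x)" if "x \<in> carrier E" for x
      using fun_cong[OF eq, of x] that by (simp add: compose_def)
    then have "f a = g a" if "a \<in> carrier G" for a using that surj by (metis imageE)
    then show "f = g" using f g
      by (intro extensionalityI[of _ "carrier G"]) (auto simp: Hom_def)
  qed
  fix u
  show "u \<in> Hom E B" if "u \<in> (\<lambda>f. compose (carrier E) f q) ` Hom G B"
    using that by (auto simp: Hom_def hom_def compose_def Pi_iff)
  show "u \<in> (\<lambda>f. compose (carrier E) f q) ` Hom G B" if u: "u \<in> Hom E B"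
  proof -
    have uh: "u \<in> hom E B" using u by (simp add: Hom_def)
    interpret u: group_hom E B u using uh by unfold_locales
    define g where "g = (\<lambda>a\<in>carrier G. u (inv_into (carrier E) q a))"
    have g: "g (q x) = u x" if x: "x \<in> carrier E" for x
    proof -
      let ?y = "inv_into (carrier E) q (q x)"
      have y: "?y \<in> carrier E" "q ?y = q x"
        using x by (auto intro: inv_into_into f_inv_into_f)
      then have "?y \<otimes>\<^bsub>E\<^esub> inv\<^bsub>E\<^esub> x \<in> kernel E G q" using x by (simp add: kernel_def)
      then have "u (?y \<otimes>\<^bsub>E\<^esub> inv\<^bsub>E\<^esub> x) = \<one>\<^bsub>B\<^esub>" using kills uh by blast
      then have "u ?y = u x" using x y B.inv_equality[of "u ?y" "inv\<^bsub>B\<^esub> u x"] by simp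
      then show ?thesis using x by (simp add: g_def)
    qed
    have "g \<in> hom G B"
    proof (rule homI)
      fix a b assume "a \<in> carrier G" "b \<in> carrier G"
      then obtain x y where xy: "x \<in> carrier E" "a = q x" "y \<in> carrier E" "b = q y"
        using surj by (metis imageE)
      then show "g a \<in> carrier B" using g by simp
      show "g (a \<otimes>\<^bsub>G\<^esub> b) = g a \<otimes>\<^bsub>B\<^esub> g b"
        using xy g[of "x \<otimes>\<^bsub>E\<^esub> y"] by (simp add: g)
    qed
    then have "g \<in> Hom G B" by (simp add: Hom_def g_def)
    moreover have "u = compose (carrier E) g q"
      using g u by (intro extensionalityI[of _ "carrier E"]) (auto simp: Hom_def compose_def)
    ultimately show ?thesis by blast
  qed
qed

section \<open>Localizations and universal central extensions\<close>

theorem corollary1p7: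
  fixes H :: "('h, 'a) monoid_scheme"
    and G :: "('g, 'b) monoid_scheme"
    and Gt :: "('e, 'c) monoid_scheme"
    and i :: "'h \<Rightarrow> 'g" and q :: "'e \<Rightarrow> 'g" and j :: "'h \<Rightarrow> 'e"
  assumes "simple_group H" and "finite (carrier H)" and "\<not> comm_group H"
    and "simple_group G" and "finite (carrier G)" and "\<not> comm_group G"
    and "i \<in> mon H G"
    and "superperfect H"
    and "universal_central_extension Gt G q"
    and "j \<in> hom H Gt" and "\<forall>h \<in> carrier H. q (j h) = i h"
  shows "localization H G i \<longleftrightarrow> localization H Gt j"
proof -
  have C: "central_extension Gt G q"
    using assms by (simp add: universal_central_extension_def)
  then have Gt: "group Gt" and G: "group G" and H: "group H" and q: "q \<in> epi Gt G"
    using assms by (auto simp: central_extension_def superperfect_def)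
  have jh: "j x \<in> carrier Gt" if "x \<in> carrier H" for x
    using that assms(10) by (auto simp: hom_def)
  have i: "i \<in> hom H G" using assms by (simp add: mon_def)
  have kills: "d z = \<one>\<^bsub>G\<^esub>" if "d \<in> hom Gt G" "z \<in> kernel Gt G q" for d z
    using hom_to_finite_simple_group_kills_kernel[OF assms(4-6) C _ that]
      universal_central_extension_no_abelian_image[OF assms(9) G] by blast
  have qpre: "bij_betw (\<lambda>f. compose (carrier Gt) f q) (Hom G G) (Hom Gt G)"
    using bij_betw_Hom_precompose_epi[OF Gt G G q] kills by blast
  have qpostGt: "bij_betw (compose (carrier Gt) q) (Hom Gt Gt) (Hom Gt G)"
  proof (rule bij_betw_Hom_central_extension[OF C Gt])
    show "no_abelian_image Gt Gt"
      using universal_central_extension_no_abelian_image[OF assms(9) Gt] .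
    fix u assume "u \<in> hom Gt G"
    then have "restrict u (carrier Gt) \<in> Hom Gt G"
      using Gt by (auto simp: Hom_def hom_def group.is_monoid monoid.m_closed)
    then obtain g where g: "g \<in> Hom G G" "restrict u (carrier Gt) = compose (carrier Gt) g q"
      using qpre by (auto simp: bij_betw_def)
    have "u x = g (q x)" if "x \<in> carrier Gt" for x
      using that fun_cong[OF g(2), of x] by (simp add: compose_def)
    then show "\<exists>f \<in> hom Gt Gt. \<forall>x \<in> carrier Gt. q (f x) = u x"
      using universal_central_extension_functorial[OF assms(9) C, of g] g(1)
      by (auto simp: Hom_def)
  qed
  have qpostH: "bij_betw (compose (carrier H) q) (Hom H Gt) (Hom H G)"
  proof (rule bij_betw_Hom_central_extension[OF C H])
    show "no_abelian_image H Gt"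
      using simple_group_no_abelian_image[OF assms(1,3) Gt] .
    fix u assume "u \<in> hom H G"
    then show "\<exists>f \<in> hom H Gt. \<forall>x \<in> carrier H. q (f x) = u x"
      using superperfect_lift[OF assms(8) C] by (metis Hom_def IntD1)
  qed
  have pre: "compose (carrier H) f j \<in> Hom H Gt" if "f \<in> Hom Gt Gt" for f
    using that assms(10) H by (auto simp: Hom_def hom_def compose_def Pi_iff group.is_monoid monoid.m_closed)
  have "bij_betw (\<lambda>f. compose (carrier H) f i) (Hom G G) (Hom H G) \<longleftrightarrow>
      bij_betw ((\<lambda>f. compose (carrier H) f j) \<circ> (\<lambda>f. compose (carrier Gt) f q)) (Hom G G) (Hom H G)"
    using assms(11) jh by (intro bij_betw_cong) (auto simp: compose_def fun_eq_iff)
  also have "\<dots> \<longleftrightarrow> bij_betw (\<lambda>f. compose (carrier H) f j) (Hom Gt G) (Hom H G)"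
    using bij_betw_comp_iff[OF qpre] by blast
  also have "\<dots> \<longleftrightarrow>
      bij_betw ((\<lambda>f. compose (carrier H) f j) \<circ> compose (carrier Gt) q) (Hom Gt Gt) (Hom H G)"
    using bij_betw_comp_iff[OF qpostGt] by blast
  also have "\<dots> \<longleftrightarrow>
      bij_betw (compose (carrier H) q \<circ> (\<lambda>f. compose (carrier H) f j)) (Hom Gt Gt) (Hom H G)"
    using jh by (intro bij_betw_cong) (auto simp: compose_def fun_eq_iff)
  also have "\<dots> \<longleftrightarrow> bij_betw (\<lambda>f. compose (carrier H) f j) (Hom Gt Gt) (Hom H Gt)"
    by (rule bij_betw_comp_iff2[OF qpostH, symmetric]) (use pre in blast)
  finally show ?thesis using i assms(10) by (simp add: localization_def)
qed

end
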